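(* Let $B=\{\mathbf{b}_1,\dots,\mathbf{b}_n\}$ be a strongly reduced basis of a lattice $\Lambda\subset\mathbb{R}^m$ of rank $n$ with successive minima $\lambda_1,\dots,\lambda_n$. Then for all $1\leq i\leq n$, $$\|\mathbf{b}_i\|^2\leq \max\left\{1,\frac{i-k_i}{4}+\frac{k_i}{16}\right\}\lambda_i^2,$$ where $k_i$ is the number of elements $j$ in the set $\{1,\dots,i-1\}$ such that $\|\mathbf{b}_j\|>\lambda_j$.
   Context: A lattice $\Lambda$ of rank $n$ is a discrete subgroup of $\mathbb{R}^m$ which is the $\mathbb{Z}$-span of an (ordered) basis $B=\{\mathbf{b}_1,\dots,\mathbf{b}_n\}$ of $\mathbb{R}$-linearly independent vectors, $1\le n\leq m$. $\|\cdot\|$ is the Euclidean norm. For $1\le i\le n$, the $i$th successive minimum $\lambda_i$ of $\Lambda$ is the smallest real $r>0$ such that the closed ball of radius $r$ centred at the origin contains at least $i$ linearly independent vectors of $\Lambda$. An ordered basis $B=\{\mathbf{b}_1,\dots,\mathbf{b}_n\}$ of $\Lambda$ is called strongly reduced if both of the following hold: (1) There exist linearly independent lattice vectors $\mathbf{v}_1,\dots,\mathbf{v}_n\in\Lambda$ with $\|\mathbf{v}_i\|=\lambda_i$ for all $1\leq i\leq n$ such that, writing $\mathbf{v}_i=\sum_{j=1}^n x_j^{(i)}\mathbf{b}_j$ with $x_j^{(i)}\in\mathbb{Z}$, one has $x_i^{(i)}\neq 0$ and $x_{i+1}^{(i)}=x_{i+2}^{(i)}=\dots=x_n^{(i)}=0$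 for every $1\leq i\leq n$. (2) For all $1\leq i\leq n$ and all $x_1,\dots,x_{i-1}\in\mathbb{Z}$, $\|\mathbf{b}_i\|\leq\left\|\mathbf{b}_i+\sum_{j=1}^{i-1}x_j\mathbf{b}_j\right\|$. *)

theory Defs
  imports "HOL-Analysis.Analysis"
begin

text \<open>Ordered families \<open>b\<^sub>1, \<dots>, b\<^sub>n\<close> are functions on \<^typ>\<open>nat\<close>, of which only
  the values at the indices \<open>1, \<dots>, n\<close> matter.\<close>

definition lin_indep_family :: "nat \<Rightarrow> (nat \<Rightarrow> 'a::real_vector) \<Rightarrow> bool" where
  "lin_indep_family n b \<longleftrightarrow> inj_on b {1..n} \<and> independent (b ` {1..n})"

definition int_comb :: "nat \<Rightarrow> (nat \<Rightarrow> 'a::real_vector) \<Rightarrow> (nat \<Rightarrow> int) \<Rightarrow> 'a" where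
  "int_comb n b x = (\<Sum>j = 1..n. of_int (x j) *\<^sub>R b j)"

definition lattice_basis :: "'a::real_vector set \<Rightarrow> nat \<Rightarrow> (nat \<Rightarrow> 'a) \<Rightarrow> bool" where
  "lattice_basis L n b \<longleftrightarrow> lin_indep_family n b \<and> L = range (int_comb n b)"

text \<open>The bound \<open>n \<le> DIM('a)\<close> on the rank follows from linear independence of a basis.\<close>

definition is_lattice :: "'a::euclidean_space set \<Rightarrow> nat \<Rightarrow> bool" where
  "is_lattice L n \<longleftrightarrow>
     1 \<le> n \<and>
     0 \<in> L \<and> (\<forall>u\<in>L. \<forall>w\<in>L. u - w \<in> L) \<and>
     discrete L \<and>
     (\<exists>b. lattice_basis L n b)"

definition successive_minimum :: "'a::euclidean_space set \<Rightarrow> nat \<Rightarrow> real" where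
  "successive_minimum L i =
     (LEAST r. 0 < r \<and> (\<exists>S \<subseteq> L \<inter> cball 0 r. independent S \<and> i \<le> card S))"

definition strongly_reduced_basis ::
  "'a::euclidean_space set \<Rightarrow> nat \<Rightarrow> (nat \<Rightarrow> 'a) \<Rightarrow> bool" where
  "strongly_reduced_basis L n b \<longleftrightarrow>
     lattice_basis L n b \<and>
     (\<exists>v x. lin_indep_family n v \<and>
        (\<forall>i\<in>{1..n}.
           v i \<in> L \<and>
           norm (v i) = successive_minimum L i \<and>
           v i = int_comb n b (x i) \<and>
           x i i \<noteq> 0 \<and>
           (\<forall>j\<in>{i+1..n}. x i j = 0))) \<and>
     (\<forall>i\<in>{1..n}. \<forall>x. norm (b i) \<le> norm (b i + int_comb (i - 1) b x))"

end

theory Submission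
  imports Defs
begin

text \<open>
  Write \<open>v\<^sub>i = \<Sum>\<^bsub>j \<le> i\<^esub> x\<^sub>i\<^sub>j b\<^sub>j\<close> for the vectors realising the successive minima, and \<open>b\<^sub>i\<^sup>*\<close> for the
  Gram-Schmidt vector of \<open>b\<^sub>i\<close>, its component orthogonal to \<open>b\<^sub>1, \<dots>, b\<^bsub>i-1\<^esub>\<close>.  Two observations
  drive the proof.

  The coefficient \<open>x\<^sub>i\<^sub>i\<close> controls \<open>b\<^sub>i\<close>.  Projecting away \<open>b\<^sub>1, \<dots>, b\<^bsub>i-1\<^esub>\<close> turns \<open>v\<^sub>i\<close> into
  \<open>x\<^sub>i\<^sub>i b\<^sub>i\<^sup>*\<close>, and projections do not increase norms, so \<open>\<parallel>b\<^sub>i\<^sup>*\<parallel> \<le> \<lambda>\<^sub>i / \<bar>x\<^sub>i\<^sub>i\<bar>\<close>.  If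
  \<open>\<bar>x\<^sub>i\<^sub>i\<bar> = 1\<close>, then \<open>\<plusminus>v\<^sub>i\<close> is itself one of the competitors in the size-reduction condition on \<open>b\<^sub>i\<close>,
  whence \<open>\<parallel>b\<^sub>i\<parallel> \<le> \<lambda>\<^sub>i\<close>.  Consequently an index \<open>j\<close> with \<open>\<parallel>b\<^sub>j\<parallel> > \<lambda>\<^sub>j\<close> has
  \<open>\<bar>x\<^sub>j\<^sub>j\<bar> \<ge> 2\<close> and contributes only \<open>\<parallel>b\<^sub>j\<^sup>*\<parallel>\<^sup>2 \<le> \<lambda>\<^sub>j\<^sup>2 / 4\<close>.

  Rounding the Gram-Schmidt coefficients one after another, from the last to the first, yields a
  vector in \<open>b\<^sub>i + \<int>b\<^sub>1 + \<dots> + \<int>b\<^bsub>i-1\<^esub>\<close> of squared norm at most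
  \<open>\<parallel>b\<^sub>i\<^sup>*\<parallel>\<^sup>2 + (\<Sum>\<^bsub>j < i\<^esub> \<parallel>b\<^sub>j\<^sup>*\<parallel>\<^sup>2) / 4\<close> (lemma \<open>nearest_plane_bound\<close>; this is Babai's
  nearest plane procedure), and \<open>b\<^sub>i\<close> is no longer than that vector.  When \<open>\<bar>x\<^sub>i\<^sub>i\<bar> \<ge> 2\<close>, the first
  term is at most \<open>\<lambda>\<^sub>i\<^sup>2 / 4\<close>; of the \<open>i - 1\<close> summands, \<open>k\<^sub>i\<close> are at most
  \<open>\<lambda>\<^sub>i\<^sup>2 / 4\<close> and the others at most \<open>\<lambda>\<^sub>i\<^sup>2\<close>, because \<open>\<lambda>\<^sub>j \<le> \<lambda>\<^sub>i\<close>.  Adding up gives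
  \<open>(i - k\<^sub>i) / 4 + k\<^sub>i / 16\<close>.
\<close>

section \<open>Gram-Schmidt residuals and the nearest plane bound\<close>

text \<open>The component of \<open>u\<close> orthogonal to \<open>b\<^sub>1, \<dots>, b\<^sub>k\<close>.  A vanishing Gram-Schmidt vector makes the
  quotient \<open>0 / 0 = 0\<close>, so dependent families are covered as well.\<close>

fun gs_residual :: "(nat \<Rightarrow> 'a::real_inner) \<Rightarrow> nat \<Rightarrow> 'a \<Rightarrow> 'a" where
  "gs_residual b 0 u = u"
| "gs_residual b (Suc k) u =
     (let d = gs_residual b k (b (Suc k)); r = gs_residual b k u
      in r - ((r \<bullet> d) / (d \<bullet> d)) *\<^sub>R d)"

lemma linear_gs_residual: "linear (gs_residual b k)"
proof (induction k)
  case 0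
  show ?case by (simp add: linear_iff)
next
  case (Suc k)
  then show ?case
    by (simp add: linear_iff Let_def inner_add_left add_divide_distrib algebra_simps)
qed

lemma norm_add_projection:
  fixes r d :: "'a::real_inner"
  shows "(norm (r + c *\<^sub>R d))\<^sup>2 =
    (norm (r - ((r \<bullet> d) / (d \<bullet> d)) *\<^sub>R d))\<^sup>2 + (c + (r \<bullet> d) / (d \<bullet> d))\<^sup>2 * (norm d)\<^sup>2"
proof -
  define m where "m = (r \<bullet> d) / (d \<bullet> d)"
  define p where "p = r - m *\<^sub>R d"
  have "orthogonal p ((c + m) *\<^sub>R d)"
    by (cases "d = 0") (simp_all add: orthogonal_def p_def m_def inner_diff_left)
  then have "(norm (p + (c + m) *\<^sub>R d))\<^sup>2 = (norm p)\<^sup>2 + (norm ((c + m) *\<^sub>R d))\<^sup>2"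
    by (rule norm_add_Pythagorean)
  moreover have "p + (c + m) *\<^sub>R d = r + c *\<^sub>R d"
    by (simp add: p_def scaleR_add_left)
  ultimately have "(norm (r + c *\<^sub>R d))\<^sup>2 = (norm p)\<^sup>2 + (c + m)\<^sup>2 * (norm d)\<^sup>2"
    by (simp only: norm_scaleR power_mult_distrib power2_abs)
  then show ?thesis
    by (simp only: p_def m_def)
qed

lemma norm_gs_residual_le: "norm (gs_residual b k u) \<le> norm u"
proof (induction k)
  case (Suc k)
  have "(norm (gs_residual b (Suc k) u))\<^sup>2 \<le> (norm (gs_residual b k u))\<^sup>2"
    using norm_add_projection[of "gs_residual b k u" 0 "gs_residual b k (b (Suc k))"]
    by (simp add: Let_def)
  with Suc show ?case
    using norm_ge_zero order_trans power2_le_imp_le by blast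
qed simp

lemma gs_residual_eq_0:
  assumes "1 \<le> j" "j \<le> k"
  shows "gs_residual b k (b j) = 0"
  using assms
proof (induction k)
  case (Suc k)
  then show ?case
    by (cases "j = Suc k") (auto simp: Let_def)
qed simp

lemma gs_residual_int_comb: "gs_residual b k (int_comb k b x) = 0"
  unfolding int_comb_def
  by (simp add: linear_sum[OF linear_gs_residual] linear_cmul[OF linear_gs_residual]
      gs_residual_eq_0)

text \<open>The coefficient of \<open>b\<^sub>k\<close>, for the largest \<open>k\<close>, is chosen first: rounding places \<open>u\<close> within half a
  Gram-Schmidt vector of the span of \<open>b\<^sub>1, \<dots>, b\<^bsub>k-1\<^esub>\<close> translated by the residual of \<open>u\<close>, at a cost of
  \<open>\<parallel>b\<^sub>k\<^sup>*\<parallel>\<^sup>2 / 4\<close>; later choices only involve \<open>b\<^sub>1, \<dots>, b\<^bsub>k-1\<^esub>\<close> and leave that cost unchanged.\<close>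

lemma nearest_plane_bound:
  fixes b :: "nat \<Rightarrow> 'a::real_inner"
  shows "\<exists>x. (norm (u + int_comb k b x))\<^sup>2
    \<le> (norm (gs_residual b k u))\<^sup>2 + (\<Sum>j = 1..k. (norm (gs_residual b (j - 1) (b j)))\<^sup>2) / 4"
proof (induction k arbitrary: u)
  case 0
  show ?case by (simp add: int_comb_def)
next
  case (Suc k)
  define d where "d = gs_residual b k (b (Suc k))"
  define r where "r = gs_residual b k u"
  define c where "c = - round ((r \<bullet> d) / (d \<bullet> d))"
  obtain x where x: "(norm (u + of_int c *\<^sub>R b (Suc k) + int_comb k b x))\<^sup>2
    \<le> (norm (gs_residual b k (u + of_int c *\<^sub>R b (Suc k))))\<^sup>2
      + (\<Sum>j = 1..k. (norm (gs_residual b (j - 1) (b j)))\<^sup>2) / 4"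
    using Suc.IH by blast
  have split: "int_comb (Suc k) b (x(Suc k := c)) = of_int c *\<^sub>R b (Suc k) + int_comb k b x"
    by (simp add: int_comb_def)
  have res: "gs_residual b k (u + of_int c *\<^sub>R b (Suc k)) = r + of_int c *\<^sub>R d"
    by (simp add: linear_add[OF linear_gs_residual] linear_cmul[OF linear_gs_residual] r_def d_def)
  have "\<bar>of_int c + (r \<bullet> d) / (d \<bullet> d)\<bar> \<le> 1 / 2"
    using of_int_round_abs_le[of "(r \<bullet> d) / (d \<bullet> d)"] unfolding c_def by linarith
  then have "(of_int c + (r \<bullet> d) / (d \<bullet> d))\<^sup>2 \<le> (1 / 2)\<^sup>2"
    by (rule power2_le_iff_abs_le[THEN iffD2, rotated]) simp
  then have "(of_int c + (r \<bullet> d) / (d \<bullet> d))\<^sup>2 * (norm d)\<^sup>2 \<le> (norm d)\<^sup>2 / 4"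
    using mult_right_mono[of _ "(1 / 2)\<^sup>2" "(norm d)\<^sup>2"] by (simp add: power2_eq_square)
  then have "(norm (r + of_int c *\<^sub>R d))\<^sup>2 \<le> (norm (gs_residual b (Suc k) u))\<^sup>2 + (norm d)\<^sup>2 / 4"
    unfolding norm_add_projection[of r "of_int c" d] by (simp add: Let_def r_def d_def)
  with x have "(norm (u + int_comb (Suc k) b (x(Suc k := c))))\<^sup>2
    \<le> (norm (gs_residual b (Suc k) u))\<^sup>2
      + (\<Sum>j = 1..Suc k. (norm (gs_residual b (j - 1) (b j)))\<^sup>2) / 4"
    unfolding split res by (simp add: add.assoc d_def add_divide_distrib del: gs_residual.simps)
  then show ?case by blast
qed

section \<open>Successive minima increase\<close>

lemma finite_lattice_cball:
  fixes L :: "'a::euclidean_space set"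
  assumes "is_lattice L n"
  shows "finite (L \<inter> cball 0 R)"
proof (rule ccontr)
  assume inf: "infinite (L \<inter> cball 0 R)"
  have 0: "0 \<in> L" and diff: "\<And>u w. u \<in> L \<Longrightarrow> w \<in> L \<Longrightarrow> u - w \<in> L" and "discrete L"
    using assms by (auto simp: is_lattice_def)
  then obtain e where e: "e > 0" "\<And>y. y \<in> L \<Longrightarrow> dist 0 y < e \<Longrightarrow> y = 0"
    unfolding discrete_def using isolated_inE_dist by metis
  \<comment> \<open>The separation radius at the origin serves at every lattice point, by translation.\<close>
  have sep: "\<forall>x\<in>L. \<forall>y\<in>L. dist y x < e \<longrightarrow> y = x"
    using e(2) diff by (metis dist_0_norm dist_norm eq_iff_diff_eq_0)
  obtain z where "z islimpt L \<inter> cball 0 R"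
    using inf compact_eq_Bolzano_Weierstrass[of "cball 0 R :: 'a set"] compact_cball
    by (metis inf_le2)
  then have "z islimpt L"
    by (meson inf_le1 islimpt_subset)
  then show False
    using discrete_imp_not_islimpt[OF e(1)] sep by blast
qed

text \<open>What needs an argument is that the least radius in the definition of a successive minimum is
  attained: a radius that works can be shrunk to the norm of one of the finitely many lattice
  points in its ball.\<close>

lemma successive_minimum_least:
  fixes L :: "'a::euclidean_space set"
  assumes L: "is_lattice L n" and i: "1 \<le> i"
    and S: "S \<subseteq> L" "independent S" "i \<le> card S"
  defines "P \<equiv> \<lambda>r. 0 < r \<and> (\<exists>S \<subseteq> L \<inter> cball 0 r. independent S \<and> i \<le> card S)"
  shows "P (successive_minimum L i)" and "\<And>r. P r \<Longrightarrow> successive_minimum L i \<le> r"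
proof -
  have shrink: "\<exists>s \<le> r. P s \<and> s \<in> norm ` (L \<inter> cball 0 r)" if "P r" for r
  proof -
    from that obtain T where T: "T \<subseteq> L \<inter> cball 0 r" "independent T" "i \<le> card T"
      by (auto simp: P_def)
    have fin: "finite T" and ne: "T \<noteq> {}" and "0 \<notin> T"
      using T i independent_imp_finite dependent_zero by auto
    define s where "s = Max (norm ` T)"
    have s: "s \<in> norm ` T" unfolding s_def using fin ne by simp
    have "T \<subseteq> cball 0 s" unfolding s_def using fin by auto
    moreover have "0 < s" using s \<open>0 \<notin> T\<close> by auto
    ultimately have "P s" unfolding P_def using T by blast
    with s T(1) show ?thesis by fastforce
  qed
  have "finite S" using S independent_imp_finite by blast
  then obtain R0 where R0: "\<forall>x\<in>S. norm x \<le> R0"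
    using finite_imp_bounded bounded_iff by metis
  define R where "R = max R0 1"
  have "P R" using R0 S unfolding P_def R_def by fastforce
  define N where "N = {s \<in> norm ` (L \<inter> cball 0 R). P s}"
  have N: "finite N" "N \<noteq> {}"
    using finite_lattice_cball[OF L] shrink[OF \<open>P R\<close>] by (auto simp: N_def)
  have Pm: "P (Min N)" using Min_in[OF N] by (simp add: N_def)
  have least: "Min N \<le> r" if "P r" for r
  proof (cases "r \<le> R")
    case True
    from shrink[OF that] obtain s where s: "s \<le> r" "P s" "s \<in> norm ` (L \<inter> cball 0 r)"
      by blast
    then have "s \<in> N" using True by (auto simp: N_def)
    then show ?thesis using s N by (meson Min_le order_trans)
  next
    case False
    then show ?thesis using Min_in[OF N] by (auto simp: N_def)
  qed
  have "successive_minimum L i = Min N"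
    unfolding successive_minimum_def P_def[symmetric]
    by (rule Least_equality[of P]) (use Pm least in auto)
  with Pm least show "P (successive_minimum L i)" "\<And>r. P r \<Longrightarrow> successive_minimum L i \<le> r"
    by auto
qed

lemma successive_minimum_mono:
  fixes L :: "'a::euclidean_space set"
  assumes "is_lattice L n" "1 \<le> i" "i \<le> j" "j \<le> n"
  shows "successive_minimum L i \<le> successive_minimum L j"
proof -
  obtain b where b: "inj_on b {1..n}" "independent (b ` {1..n})" and L: "L = range (int_comb n b)"
    using assms(1) by (auto simp: is_lattice_def lattice_basis_def lin_indep_family_def)
  have "b k \<in> L" if "k \<in> {1..n}" for k
  proof -
    have "b k = int_comb n b (\<lambda>j. if j = k then 1 else 0)"
      using that by (simp add: int_comb_def if_distrib if_distribR cong: if_cong)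
    then show ?thesis using L by blast
  qed
  then have S: "b ` {1..n} \<subseteq> L" by blast
  have card: "card (b ` {1..n}) = n" using b card_image by fastforce
  have "0 < successive_minimum L j" and
    "\<exists>S \<subseteq> L \<inter> cball 0 (successive_minimum L j). independent S \<and> j \<le> card S"
    using successive_minimum_least(1)[OF assms(1) _ S b(2), of j] assms card by auto
  then have "0 < successive_minimum L j \<and>
      (\<exists>S \<subseteq> L \<inter> cball 0 (successive_minimum L j). independent S \<and> i \<le> card S)"
    using \<open>i \<le> j\<close> by (meson order_trans)
  moreover have "i \<le> card (b ` {1..n})" using assms card by simp
  ultimately show ?thesis
    using successive_minimum_least(2)[OF assms(1) \<open>1 \<le> i\<close> S b(2)] by blast
qed

section \<open>Strongly reduced bases\<close>

lemma int_comb_lower_triangular: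
  fixes b :: "nat \<Rightarrow> 'a::real_vector"
  assumes "i \<in> {1..n}" "\<forall>j\<in>{i+1..n}. x j = 0"
  shows "int_comb n b x = of_int (x i) *\<^sub>R b i + int_comb (i - 1) b x"
proof -
  have "int_comb n b x = (\<Sum>j\<in>{1..i}. of_int (x j) *\<^sub>R b j)"
    unfolding int_comb_def by (rule sum.mono_neutral_right) (use assms in auto)
  also have "{1..i} = insert i {1..i - 1}" using assms(1) by auto
  also have "(\<Sum>j\<in>\<dots>. of_int (x j) *\<^sub>R b j) = of_int (x i) *\<^sub>R b i + int_comb (i - 1) b x"
    unfolding int_comb_def by (rule sum.insert) (use assms(1) in auto)
  finally show ?thesis .
qed

theorem theorem1:
  fixes L :: "(real ^ 'm) set" and n :: nat and b :: "nat \<Rightarrow> real ^ 'm"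
  assumes "is_lattice L n"
    and "strongly_reduced_basis L n b"
  shows "\<forall>i\<in>{1..n}.
    let k = card {j \<in> {1..i - 1}. norm (b j) > successive_minimum L j}
    in (norm (b i))\<^sup>2
         \<le> max 1 ((real i - real k) / 4 + real k / 16) * (successive_minimum L i)\<^sup>2"
proof -
  let ?l = "successive_minimum L"
  define g where "g j = norm (gs_residual b (j - 1) (b j))" for j
  obtain v x where vx: "\<forall>i\<in>{1..n}. v i \<in> L \<and> norm (v i) = ?l i \<and> v i = int_comb n b (x i) \<and>
      x i i \<noteq> 0 \<and> (\<forall>j\<in>{i+1..n}. x i j = 0)"
    and size_reduced: "\<And>i y. i \<in> {1..n} \<Longrightarrow> norm (b i) \<le> norm (b i + int_comb (i - 1) b y)"
    using assms(2) unfolding strongly_reduced_basis_def by blast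
  have v: "v i = of_int (x i i) *\<^sub>R b i + int_comb (i - 1) b (x i)" if "i \<in> {1..n}" for i
    using int_comb_lower_triangular[OF that, of "x i" b] vx that by auto
  have norm_v: "norm (v i) = ?l i" and nz: "x i i \<noteq> 0" if "i \<in> {1..n}" for i
    using vx that by blast+
  have coeff: "\<bar>of_int (x i i)\<bar> * g i \<le> ?l i" if "i \<in> {1..n}" for i
  proof -
    have "gs_residual b (i - 1) (v i) = of_int (x i i) *\<^sub>R gs_residual b (i - 1) (b i)"
      unfolding v[OF that]
      by (simp add: linear_add[OF linear_gs_residual] linear_cmul[OF linear_gs_residual]
          gs_residual_int_comb)
    then show ?thesis
      using norm_gs_residual_le[of b "i - 1" "v i"] norm_v[OF that]
      by (simp add: g_def)
  qed
  have unit: "norm (b i) \<le> ?l i" if i: "i \<in> {1..n}" and "\<bar>x i i\<bar> = 1" for i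
  proof -
    have sq: "x i i * x i i = 1" using that(2) by (auto simp: abs_if split: if_splits)
    have "of_int (x i i) *\<^sub>R v i = b i + int_comb (i - 1) b (\<lambda>j. x i i * x i j)"
      unfolding v[OF i]
      by (simp add: scaleR_add_right int_comb_def scaleR_sum_right sq flip: of_int_mult)
    then have "norm (b i) \<le> norm (of_int (x i i) *\<^sub>R v i)"
      using size_reduced[OF i] by metis
    also have "\<dots> = ?l i" using that norm_v[OF i] by (simp flip: of_int_abs)
    finally show ?thesis .
  qed
  have g_le: "g i \<le> ?l i" if "i \<in> {1..n}" for i
  proof -
    have "1 * g i \<le> \<bar>of_int (x i i)\<bar> * g i"
      using nz[OF that] by (intro mult_right_mono) (auto simp: g_def simp flip: of_int_abs)
    with coeff[OF that] show ?thesis by simp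
  qed
  have g_half: "g i \<le> ?l i / 2" if "i \<in> {1..n}" "\<not> norm (b i) \<le> ?l i" for i
  proof -
    have "2 \<le> \<bar>x i i\<bar>" using unit[OF that(1)] nz[OF that(1)] that(2) by linarith
    then have "2 \<le> \<bar>real_of_int (x i i)\<bar>" by linarith
    then have "2 * g i \<le> \<bar>of_int (x i i)\<bar> * g i"
      by (intro mult_right_mono) (auto simp: g_def)
    with coeff[OF that(1)] show ?thesis by simp
  qed
  show ?thesis
  proof (intro ballI, unfold Let_def)
    fix i assume i: "i \<in> {1..n}"
    define K where "K = {j \<in> {1..i - 1}. norm (b j) > ?l j}"
    define c where "c = (real i - real (card K)) / 4 + real (card K) / 16"
    have "(norm (b i))\<^sup>2 \<le> max 1 c * (?l i)\<^sup>2"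
    proof (cases "norm (b i) \<le> ?l i")
      case True
      then have "(norm (b i))\<^sup>2 \<le> 1 * (?l i)\<^sup>2" by (simp add: power_mono)
      also have "\<dots> \<le> max 1 c * (?l i)\<^sup>2" by (intro mult_right_mono) auto
      finally show ?thesis .
    next
      case False
      have K: "K \<subseteq> {1..i - 1}" by (auto simp: K_def)
      have card_K: "card K \<le> i - 1" using card_mono[OF _ K] by simp
      have mono: "?l j \<le> ?l i" and jn: "j \<in> {1..n}" if "j \<in> {1..i - 1}" for j
        using successive_minimum_mono[OF assms(1), of j i] that i by auto
      have small: "(g j)\<^sup>2 \<le> (?l i)\<^sup>2 / 4" if "j \<in> K" for j
      proof -
        have "j \<in> {1..i - 1}" "\<not> norm (b j) \<le> ?l j" using that by (auto simp: K_def)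
        then have "g j \<le> ?l i / 2" using g_half[OF jn] mono by fastforce
        then have "(g j)\<^sup>2 \<le> (?l i / 2)\<^sup>2" by (intro power_mono) (auto simp: g_def)
        then show ?thesis by (simp add: power_divide)
      qed
      have large: "(g j)\<^sup>2 \<le> (?l i)\<^sup>2" if "j \<in> {1..i - 1} - K" for j
      proof -
        have "j \<in> {1..i - 1}" using that by blast
        then have "g j \<le> ?l i" using g_le[OF jn] mono by fastforce
        then show ?thesis by (intro power_mono) (auto simp: g_def)
      qed
      have "(\<Sum>j = 1..i - 1. (g j)\<^sup>2) = (\<Sum>j\<in>{1..i - 1} - K. (g j)\<^sup>2) + (\<Sum>j\<in>K. (g j)\<^sup>2)"
        using sum.subset_diff[OF K] by blast
      also have "\<dots> \<le> real (card ({1..i - 1} - K)) * (?l i)\<^sup>2 + real (card K) * ((?l i)\<^sup>2 / 4)"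
        using small large by (intro add_mono sum_bounded_above) auto
      also have "real (card ({1..i - 1} - K)) = real i - 1 - real (card K)"
      proof -
        have "card ({1..i - 1} - K) = i - 1 - card K"
          using card_Diff_subset[OF finite_subset[OF K] K] by simp
        then show ?thesis using card_K i by auto
      qed
      finally have sum: "(\<Sum>j = 1..i - 1. (g j)\<^sup>2)
        \<le> (real i - 1 - real (card K)) * (?l i)\<^sup>2 + real (card K) * ((?l i)\<^sup>2 / 4)" .
      have "(g i)\<^sup>2 \<le> (?l i / 2)\<^sup>2"
        using g_half[OF i False] by (intro power_mono) (auto simp: g_def)
      then have gi: "(g i)\<^sup>2 \<le> (?l i)\<^sup>2 / 4" by (simp add: power_divide)
      obtain y where y: "(norm (b i + int_comb (i - 1) b y))\<^sup>2
          \<le> (g i)\<^sup>2 + (\<Sum>j = 1..i - 1. (g j)\<^sup>2) / 4"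
        using nearest_plane_bound[of "b i" "i - 1" b] unfolding g_def by blast
      have "(norm (b i))\<^sup>2 \<le> (norm (b i + int_comb (i - 1) b y))\<^sup>2"
        using size_reduced[OF i] by (intro power_mono) auto
      also have "\<dots> \<le> (?l i)\<^sup>2 / 4
          + ((real i - 1 - real (card K)) * (?l i)\<^sup>2 + real (card K) * ((?l i)\<^sup>2 / 4)) / 4"
        by (rule order_trans[OF y]) (intro add_mono gi divide_right_mono sum zero_le_numeral)
      also have "\<dots> = c * (?l i)\<^sup>2"
        unfolding c_def by (simp add: algebra_simps add_divide_distrib diff_divide_distrib)
      also have "\<dots> \<le> max 1 c * (?l i)\<^sup>2" by (intro mult_right_mono) auto
      finally show ?thesis .
    qed
    then show "(norm (b i))\<^sup>2 \<le> max 1 ((real i - real (card {j \<in> {1..i - 1}. norm (b j) > ?l j})) / 4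
        + real (card {j \<in> {1..i - 1}. norm (b j) > ?l j}) / 16) * (?l i)\<^sup>2"
      by (simp only: c_def K_def)
  qed
qed

end
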